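(* Let $\alpha: I\to E_1^3$ be a non-lightlike curve and let $\beta$ be a non-lightlike Bertrand-direction curve of $\alpha$. Then the following are equivalent: (i) $\alpha$ is a helix. (ii) $\alpha$ is a Bertrand-donor curve of a helix. (iii) A Bertrand-direction curve of $\alpha$ is a helix.
   Context: $E_1^3$ is $\mathbb{R}^3$ with the metric $\langle x,y\rangle=-x_1y_1+x_2y_2+x_3y_3$ and the Lorentz vector product $x\times y=(x_2y_3-x_3y_2,\ x_1y_3-x_3y_1,\ x_2y_1-x_1y_2)$. A vector $x$ is spacelike if $\langle x,x\rangle>0$ or $x=0$, timelike if $\langle x,x\rangle<0$, lightlike if $\langle x,x\rangle=0$ and $x\ne0$. A curve is timelike (spacelike) if all its velocity vectors are; non-lightlike means timelike or spacelike; unit speed means $|\langle\alpha',\alpha'\rangle|=1$. All curves are unit speed Frenet curves, as differentiable as needed. A unit speed non-lightlike curve $\alpha(s)$ has Frenet frame $\{T,N,B\}$ (orthonormal, non-lightlike vectors, $T=\alpha'$), curvature $\kappa$ and torsion $\tau$ with $T'=\kappa N,\ N'=\varepsilon_B\kappa T+\tau B,\ B'=\varepsilon_T\tau N$, where $\varepsilon_Y=\langle Y,Y\rangle=\pm1$ and $\varepsilon_B=-\varepsilon_T\varepsilon_N$; the frame satisfies $B=\varepsilon_T\varepsilon_N T\times N$, $N=\varepsilon_B\varepsilon_T B\times T$, $T=\varepsilon_N\varepsilon_B N\times B$. It is a Frenet curve if $\kappa\neq0$. A spacelike curve is of type 1 if $N$ is timelike (and $T,B$ spacelike), of type 2 if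 $B$ is timelike (and $T,N$ spacelike). Let $X=uT+vN+wB$ with $u,v,w$ differentiable and $\varepsilon_Tu^2+\varepsilon_Nv^2+\varepsilon_Bw^2=\pm1$ (constant sign). An $X$-direction curve of $\alpha$ is a curve $\beta$ with tangent $\overline T=X$; $s$ is also arc-length for $\beta$. The Frenet frame, curvature and torsion of $\beta$ are $\{\overline T,\overline N,\overline B\},\overline\kappa,\overline\tau$, with $\overline\kappa\ne0$. $\beta$ is a Bertrand-direction curve of $\alpha$, and $\alpha$ a Bertrand-donor curve of $\beta$, if $\beta$ is an $X$-direction curve of $\alpha$ and a Bertrand curve of $\alpha$ with $\alpha$ its Bertrand partner curve (i.e. $\overline N=N$); explicitly, for a constant $\theta$, $X$ is: $\cosh\theta\,T+\sinh\theta\,B$ if $\alpha$ is timelike (resp. spacelike of type 2) and $X$ timelike (resp. spacelike); $\sinh\theta\,T+\cosh\theta\,B$ if $\alpha$ is timelike (resp. spacelike of type 2) and $X$ spacelike (resp. timelike); $\cos\theta\,T+\sin\theta\,B$ if $\alpha$ is spacelike of type 1 and $X$ spacelike. A (general) helix is a curve for which the ratio of its non-zero curvature to its non-zero torsion is a constant function.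
   Formalization: The torsion of α is assumed not identically zero, and for the equivalence with the given β being a helix also that of β, since a helix needs non-zero torsion and plane curves are counterexamples; in (ii) and (iii) the helix is otherwise some Bertrand-direction curve of α. *)

theory Defs
  imports "HOL-Analysis.Analysis"
begin

definition mdot :: "real^3 \<Rightarrow> real^3 \<Rightarrow> real" where
  "mdot x y = - (x$1 * y$1) + x$2 * y$2 + x$3 * y$3"

definition mcross :: "real^3 \<Rightarrow> real^3 \<Rightarrow> real^3" where
  "mcross x y = vector [x$2 * y$3 - x$3 * y$2, x$1 * y$3 - x$3 * y$1, x$2 * y$1 - x$1 * y$2]"

definition spacelike :: "real^3 \<Rightarrow> bool" where
  "spacelike x \<longleftrightarrow> mdot x x > 0 \<or> x = 0"

definition timelike :: "real^3 \<Rightarrow> bool" where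
  "timelike x \<longleftrightarrow> mdot x x < 0"

definition spacelike_curve :: "real set \<Rightarrow> (real \<Rightarrow> real^3) \<Rightarrow> bool" where
  "spacelike_curve I \<alpha> \<longleftrightarrow> (\<forall>s\<in>I. spacelike (vector_derivative \<alpha> (at s within I)))"

definition timelike_curve :: "real set \<Rightarrow> (real \<Rightarrow> real^3) \<Rightarrow> bool" where
  "timelike_curve I \<alpha> \<longleftrightarrow> (\<forall>s\<in>I. timelike (vector_derivative \<alpha> (at s within I)))"

definition nonlightlike_curve :: "real set \<Rightarrow> (real \<Rightarrow> real^3) \<Rightarrow> bool" where
  "nonlightlike_curve I \<alpha> \<longleftrightarrow> timelike_curve I \<alpha> \<or> spacelike_curve I \<alpha>"

record frenet_data =
  tangent :: "real \<Rightarrow> real^3"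
  normal :: "real \<Rightarrow> real^3"
  binormal :: "real \<Rightarrow> real^3"
  curvature :: "real \<Rightarrow> real"
  torsion :: "real \<Rightarrow> real"

text \<open>
  Unit speed Frenet curve with its frame. The curvature is only required to be nonzero, not
  positive, so on an interval the data are determined by the curve up to the simultaneous sign
  change of normal, binormal and curvature (the torsion is unaffected).
  The sign relation between the three causal characters and the other two vector product formulas
  for the frame follow from orthonormality and the formula for the binormal.
\<close>
definition frenet_curve :: "real set \<Rightarrow> (real \<Rightarrow> real^3) \<Rightarrow> frenet_data \<Rightarrow> bool" where
  "frenet_curve I \<alpha> F \<longleftrightarrow>
     (\<forall>s\<in>I.
       let T = tangent F s; N = normal F s; B = binormal F s;
           \<kappa> = curvature F s; \<tau> = torsion F s;
           \<epsilon>T = mdot T T; \<epsilon>N = mdot N N; \<epsilon>B = mdot B B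
       in \<bar>\<epsilon>T\<bar> = 1 \<and> \<bar>\<epsilon>N\<bar> = 1 \<and> \<bar>\<epsilon>B\<bar> = 1 \<and>
          mdot T N = 0 \<and> mdot T B = 0 \<and> mdot N B = 0 \<and>
          B = (\<epsilon>T * \<epsilon>N) *\<^sub>R mcross T N \<and>
          \<kappa> \<noteq> 0 \<and>
          (\<alpha> has_vector_derivative T) (at s within I) \<and>
          (tangent F has_vector_derivative \<kappa> *\<^sub>R N) (at s within I) \<and>
          (normal F has_vector_derivative (\<epsilon>B * \<kappa>) *\<^sub>R T + \<tau> *\<^sub>R B) (at s within I) \<and>
          (binormal F has_vector_derivative (\<epsilon>T * \<tau>) *\<^sub>R N) (at s within I))"

definition unit_field_along :: "real set \<Rightarrow> frenet_data \<Rightarrow> (real \<Rightarrow> real^3) \<Rightarrow> bool" where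
  "unit_field_along I F X \<longleftrightarrow>
     (\<exists>u v w. u differentiable_on I \<and> v differentiable_on I \<and> w differentiable_on I \<and>
        (\<forall>s\<in>I. X s = u s *\<^sub>R tangent F s + v s *\<^sub>R normal F s + w s *\<^sub>R binormal F s) \<and>
        (\<exists>\<delta>\<in>{1, -1}. \<forall>s\<in>I.
           mdot (tangent F s) (tangent F s) * (u s)\<^sup>2 +
           mdot (normal F s) (normal F s) * (v s)\<^sup>2 +
           mdot (binormal F s) (binormal F s) * (w s)\<^sup>2 = \<delta>))"

definition direction_curve ::
    "real set \<Rightarrow> (real \<Rightarrow> real^3) \<Rightarrow> frenet_data \<Rightarrow> (real \<Rightarrow> real^3) \<Rightarrow> frenet_data \<Rightarrow> bool" where
  "direction_curve I X F \<beta> G \<longleftrightarrow>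
     unit_field_along I F X \<and> frenet_curve I \<beta> G \<and> (\<forall>s\<in>I. tangent G s = X s)"

text \<open>
  Equality of the normals is meant for a suitable choice of the Frenet data of both curves. It forces
  \<open>v = 0\<close> and \<open>u\<close>, \<open>w\<close> constant, hence gives the usual expressions of \<open>X\<close> by
  \<open>cosh \<theta>\<close>, \<open>sinh \<theta>\<close> (or \<open>cos \<theta>\<close>, \<open>sin \<theta>\<close>) with \<open>\<theta>\<close> constant, up to the sign of \<open>X\<close>.
\<close>
definition bertrand_direction_curve ::
    "real set \<Rightarrow> (real \<Rightarrow> real^3) \<Rightarrow> (real \<Rightarrow> real^3) \<Rightarrow> bool" where
  "bertrand_direction_curve I \<beta> \<alpha> \<longleftrightarrow>
     (\<exists>F G X. frenet_curve I \<alpha> F \<and> direction_curve I X F \<beta> G \<and>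
        (\<forall>s\<in>I. normal G s = normal F s))"

definition bertrand_donor_curve ::
    "real set \<Rightarrow> (real \<Rightarrow> real^3) \<Rightarrow> (real \<Rightarrow> real^3) \<Rightarrow> bool" where
  "bertrand_donor_curve I \<alpha> \<beta> \<longleftrightarrow> bertrand_direction_curve I \<beta> \<alpha>"

definition helix :: "real set \<Rightarrow> (real \<Rightarrow> real^3) \<Rightarrow> bool" where
  "helix I \<alpha> \<longleftrightarrow>
     (\<exists>F. frenet_curve I \<alpha> F \<and> (\<forall>s\<in>I. curvature F s \<noteq> 0 \<and> torsion F s \<noteq> 0) \<and>
        (\<exists>c. \<forall>s\<in>I. curvature F s / torsion F s = c))"

end

theory Submission imports Defs begin

text \<open>
  All curves involved share their normal line: two Frenet frames of one curve have parallel normals,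
  and a Bertrand-direction curve shares the normal of its donor. Along frames with parallel normals
  every scalar product between a tangent or binormal of one frame and a tangent or binormal of the
  other has derivative zero. Comparing the derivatives of the two normals therefore expresses
  curvature and torsion of one curve as linear combinations of those of the other, with constant
  coefficients, and so transports the constancy of the ratio. The curve is a Bertrand-direction curve
  of itself, which gives the two existence statements.
\<close>

lemma bounded_bilinear_mdot: "bounded_bilinear mdot"
proof -
  have "bilinear mdot"
    unfolding bilinear_def linear_iff mdot_def by (auto simp: algebra_simps)
  then show ?thesis by (simp add: bilinear_conv_bounded_bilinear)
qed

interpretation mdot: bounded_bilinear mdot
  by (rule bounded_bilinear_mdot)

lemma mdot_commute: "mdot x y = mdot y x"
  by (simp add: mdot_def mult.commute)

lemmas mdot_simps = mdot.add_left mdot.add_right mdot.scaleR_left mdot.scaleR_right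

text \<open>This is the product rule for \<open>mdot\<close>. It is the source of every constant
  below: causal characters, coefficients of the linear relations, and the factor between parallel
  normals.\<close>

lemma mdot_constant:
  assumes "convex I"
    and "\<And>s. s \<in> I \<Longrightarrow> (f has_vector_derivative f' s) (at s within I)"
    and "\<And>s. s \<in> I \<Longrightarrow> (g has_vector_derivative g' s) (at s within I)"
    and "\<And>s. s \<in> I \<Longrightarrow> mdot (f s) (g' s) + mdot (f' s) (g s) = 0"
  obtains c where "\<And>s. s \<in> I \<Longrightarrow> mdot (f s) (g s) = c"
proof -
  have "((\<lambda>s. mdot (f s) (g s)) has_vector_derivative 0) (at s within I)" if "s \<in> I" for s
    using mdot.has_vector_derivative[OF assms(2,3)[OF that]] assms(4)[OF that] by simp
  then show thesis
    using has_vector_derivative_zero_constant[OF assms(1)] that by metis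
qed

text \<open>Makes derivatives within \<open>I\<close> unique, also at endpoints that belong to
  \<open>I\<close>: a connected set with more than one point has no isolated points.\<close>

lemma interval_within_nontrivial:
  fixes I :: "real set"
  assumes "is_interval I" and "interior I \<noteq> {}" and "s \<in> I"
  shows "at s within I \<noteq> bot"
proof -
  have "\<nexists>a. I = {a}" using assms(2) by auto
  then have "s islimpt I"
    using connected_imp_perfect[of I s] assms by (auto simp: is_interval_connected)
  then show ?thesis by (simp add: trivial_limit_within)
qed

lemma frenet_curveD:
  assumes "frenet_curve I \<alpha> F" and "s \<in> I"
  shows "\<bar>mdot (tangent F s) (tangent F s)\<bar> = 1"
    and "\<bar>mdot (normal F s) (normal F s)\<bar> = 1"
    and "\<bar>mdot (binormal F s) (binormal F s)\<bar> = 1"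
    and "mdot (tangent F s) (normal F s) = 0"
    and "mdot (tangent F s) (binormal F s) = 0"
    and "mdot (normal F s) (binormal F s) = 0"
    and "curvature F s \<noteq> 0"
    and "(\<alpha> has_vector_derivative tangent F s) (at s within I)"
    and "(tangent F has_vector_derivative curvature F s *\<^sub>R normal F s) (at s within I)"
    and "(normal F has_vector_derivative
           (mdot (binormal F s) (binormal F s) * curvature F s) *\<^sub>R tangent F s
           + torsion F s *\<^sub>R binormal F s) (at s within I)"
    and "(binormal F has_vector_derivative
           (mdot (tangent F s) (tangent F s) * torsion F s) *\<^sub>R normal F s) (at s within I)"
  using assms unfolding frenet_curve_def Let_def by auto

text \<open>The factor is chosen pointwise, without continuity, so the relation is plainly symmetric
  and transitive and allows for the sign ambiguity of Frenet frames.\<close>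

definition parallel_normals :: "real set \<Rightarrow> frenet_data \<Rightarrow> frenet_data \<Rightarrow> bool" where
  "parallel_normals I F G \<longleftrightarrow> (\<forall>s\<in>I. \<exists>r. r \<noteq> 0 \<and> normal G s = r *\<^sub>R normal F s)"

lemma parallel_normals_sym:
  assumes "parallel_normals I F G" shows "parallel_normals I G F"
  unfolding parallel_normals_def
proof
  fix s assume "s \<in> I"
  then obtain r where "r \<noteq> 0" "normal G s = r *\<^sub>R normal F s"
    using assms by (auto simp: parallel_normals_def)
  then show "\<exists>r. r \<noteq> 0 \<and> normal F s = r *\<^sub>R normal G s"
    by (intro exI[of _ "inverse r"]) simp
qed

lemma parallel_normals_trans:
  assumes "parallel_normals I F G" and "parallel_normals I G H"
  shows "parallel_normals I F H"
  unfolding parallel_normals_def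
proof
  fix s assume "s \<in> I"
  then obtain r q where "r \<noteq> 0" "normal G s = r *\<^sub>R normal F s"
    "q \<noteq> 0" "normal H s = q *\<^sub>R normal G s"
    using assms unfolding parallel_normals_def by meson
  then show "\<exists>r. r \<noteq> 0 \<and> normal H s = r *\<^sub>R normal F s"
    by (intro exI[of _ "q * r"]) simp
qed

text \<open>Both tangents are the derivative of \<alpha>, so the two expressions curvature times
  normal for their derivative agree. Nonzero curvatures then give a nonzero factor.\<close>

lemma parallel_normals_same_curve:
  assumes I: "is_interval I" "interior I \<noteq> {}"
    and F: "frenet_curve I \<alpha> F" and G: "frenet_curve I \<alpha> G"
  shows "parallel_normals I F G"
  unfolding parallel_normals_def
proof
  fix s assume s: "s \<in> I"
  note nontriv = interval_within_nontrivial[OF I]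
  have T: "tangent F t = tangent G t" if "t \<in> I" for t
    using vector_derivative_unique_within[OF nontriv] frenet_curveD(8) F G that by blast
  have "(tangent G has_vector_derivative curvature F s *\<^sub>R normal F s) (at s within I)"
    by (rule has_vector_derivative_transform[OF s _ frenet_curveD(9)[OF F s]]) (simp add: T)
  then have "curvature F s *\<^sub>R normal F s = curvature G s *\<^sub>R normal G s"
    using vector_derivative_unique_within[OF nontriv[OF s]] frenet_curveD(9)[OF G s] by blast
  then have "(1 / curvature G s) *\<^sub>R curvature G s *\<^sub>R normal G s
      = (1 / curvature G s) *\<^sub>R curvature F s *\<^sub>R normal F s" by simp
  then have "normal G s = (curvature F s / curvature G s) *\<^sub>R normal F s"
    using frenet_curveD(7)[OF G s] by simp
  then show "\<exists>r. r \<noteq> 0 \<and> normal G s = r *\<^sub>R normal F s"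
    using frenet_curveD(7)[OF F s] frenet_curveD(7)[OF G s] by (meson divide_eq_0_iff)
qed

text \<open>The derivative of a normal is a combination of tangent and binormal with coefficients
  curvature and torsion, up to sign. Differentiating \<open>normal G = r0 * normal F\<close> with
  \<open>r0\<close> constant and pairing with the tangent and the binormal of \<open>G\<close>
  isolates the curvature and the torsion of \<open>G\<close>.\<close>

lemma parallel_normals_linear_relation:
  assumes I: "is_interval I" "interior I \<noteq> {}"
    and F: "frenet_curve I \<alpha> F" and G: "frenet_curve I \<gamma> G"
    and par: "parallel_normals I F G"
  obtains a b c d where
    "\<And>s. s \<in> I \<Longrightarrow> curvature G s = a * curvature F s + b * torsion F s"
    "\<And>s. s \<in> I \<Longrightarrow> torsion G s = c * curvature F s + d * torsion F s"
proof -
  have cvx: "convex I" using I(1) by (simp add: is_interval_convex)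
  obtain r where r: "\<And>s. s \<in> I \<Longrightarrow> r s \<noteq> 0" "\<And>s. s \<in> I \<Longrightarrow> normal G s = r s *\<^sub>R normal F s"
    using par unfolding parallel_normals_def by metis
  note FD = frenet_curveD[OF F] and GD = frenet_curveD[OF G]
  have perpF: "mdot (normal F s) (tangent F s) = 0" "mdot (binormal F s) (tangent F s) = 0"
    "mdot (binormal F s) (normal F s) = 0" if "s \<in> I" for s
    using FD(4-6)[OF that] by (simp_all add: mdot_commute)
  have perpG: "mdot (normal G s) (tangent G s) = 0" "mdot (binormal G s) (tangent G s) = 0"
    "mdot (binormal G s) (normal G s) = 0" if "s \<in> I" for s
    using GD(4-6)[OF that] by (simp_all add: mdot_commute)
  \<comment> \<open>\<open>normal F\<close> is orthogonal to the tangent and binormal of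
    \<open>G\<close> because \<open>normal G\<close> is a nonzero multiple of it.\<close>
  have perpFG: "mdot (tangent G s) (normal F s) = 0" "mdot (normal F s) (tangent G s) = 0"
    "mdot (binormal G s) (normal F s) = 0" "mdot (normal F s) (binormal G s) = 0"
    if "s \<in> I" for s
    using GD(4)[OF that] perpG[OF that] r[OF that] GD(6)[OF that] by (simp_all add: mdot_simps)
  note perp = FD(4-6) perpF GD(4-6) perpG perpFG
  \<comment> \<open>\<open>frenet_curve\<close> fixes the causal characters only pointwise as 1 or
    -1; that they do not jump along \<open>I\<close> comes from differentiation.\<close>
  obtain eNF where eNF: "\<And>s. s \<in> I \<Longrightarrow> mdot (normal F s) (normal F s) = eNF"
    by (rule mdot_constant[OF cvx FD(10) FD(10)]) (simp_all add: mdot_simps perp)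
  obtain eBF where eBF: "\<And>s. s \<in> I \<Longrightarrow> mdot (binormal F s) (binormal F s) = eBF"
    by (rule mdot_constant[OF cvx FD(11) FD(11)]) (simp_all add: mdot_simps perp)
  obtain eTG where eTG: "\<And>s. s \<in> I \<Longrightarrow> mdot (tangent G s) (tangent G s) = eTG"
    by (rule mdot_constant[OF cvx GD(9) GD(9)]) (simp_all add: mdot_simps perp)
  obtain eBG where eBG: "\<And>s. s \<in> I \<Longrightarrow> mdot (binormal G s) (binormal G s) = eBG"
    by (rule mdot_constant[OF cvx GD(11) GD(11)]) (simp_all add: mdot_simps perp)
  \<comment> \<open>Tangents and binormals of both frames have derivatives along the common normal
    line, which is orthogonal to all of them. Hence the four mixed products are constant.\<close>
  obtain p where p: "\<And>s. s \<in> I \<Longrightarrow> mdot (tangent F s) (tangent G s) = p"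
    by (rule mdot_constant[OF cvx FD(9) GD(9)]) (simp_all add: mdot_simps perp r(2))
  obtain q where q: "\<And>s. s \<in> I \<Longrightarrow> mdot (binormal F s) (tangent G s) = q"
    by (rule mdot_constant[OF cvx FD(11) GD(9)]) (simp_all add: mdot_simps perp r(2))
  obtain x where x: "\<And>s. s \<in> I \<Longrightarrow> mdot (tangent F s) (binormal G s) = x"
    by (rule mdot_constant[OF cvx FD(9) GD(11)]) (simp_all add: mdot_simps perp r(2))
  obtain y where y: "\<And>s. s \<in> I \<Longrightarrow> mdot (binormal F s) (binormal G s) = y"
    by (rule mdot_constant[OF cvx FD(11) GD(11)]) (simp_all add: mdot_simps perp r(2))
  \<comment> \<open>Here the derivatives are combinations of tangents and binormals, all orthogonal
    to the common normal line.\<close>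
  have "mdot (normal F s) ((mdot (binormal G s) (binormal G s) * curvature G s) *\<^sub>R tangent G s
        + torsion G s *\<^sub>R binormal G s)
      + mdot ((mdot (binormal F s) (binormal F s) * curvature F s) *\<^sub>R tangent F s
        + torsion F s *\<^sub>R binormal F s) (normal G s) = 0" if "s \<in> I" for s
    using that by (simp add: mdot_simps perp r(2))
  then obtain m where m: "\<And>s. s \<in> I \<Longrightarrow> mdot (normal F s) (normal G s) = m"
    using mdot_constant[OF cvx FD(10) GD(10)] by blast
  \<comment> \<open>The constant \<open>m\<close> equals \<open>r s * eNF\<close> and
    \<open>eNF\<close> is 1 or -1, so the pointwise factor \<open>r\<close> is constant.\<close>
  define r0 where "r0 = m / eNF"
  have rc: "r s = r0" if "s \<in> I" for s
    using m[OF that] eNF[OF that] FD(2)[OF that] r(2)[OF that]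
    by (auto simp: mdot_simps r0_def)
  \<comment> \<open>Both sides are the derivative of \<open>normal G\<close> at \<open>s\<close>;
    since \<open>r0\<close> is constant, no derivative of the factor appears.\<close>
  have rel: "r0 *\<^sub>R ((eBF * curvature F s) *\<^sub>R tangent F s + torsion F s *\<^sub>R binormal F s)
      = (eBG * curvature G s) *\<^sub>R tangent G s + torsion G s *\<^sub>R binormal G s" (is "?l = _")
    if s: "s \<in> I" for s
  proof -
    have "((\<lambda>t. r0 *\<^sub>R normal F t) has_vector_derivative ?l) (at s within I)"
      using bounded_linear.has_vector_derivative[OF bounded_linear_scaleR_right FD(10)[OF s], of r0]
      by (simp add: eBF[OF s])
    then have "(normal G has_vector_derivative ?l) (at s within I)"
      by (rule has_vector_derivative_transform[OF s, rotated]) (simp add: r(2) rc)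
    then show ?thesis
      using vector_derivative_unique_within[OF interval_within_nontrivial[OF I s]] GD(10)[OF s]
      by (simp add: eBG[OF s])
  qed
  show thesis
  proof
    fix s assume s: "s \<in> I"
    have nz: "eTG \<noteq> 0" "eBG \<noteq> 0" using GD(1,3)[OF s] eTG[OF s] eBG[OF s] by auto
    have "r0 * (eBF * curvature F s * p + torsion F s * q) = eBG * curvature G s * eTG"
      using arg_cong[OF rel[OF s], of "\<lambda>v. mdot v (tangent G s)"] s
      by (simp add: mdot_simps perp p q eTG del: scaleR_add_right)
    then show "curvature G s = r0 * eBF * p / (eBG * eTG) * curvature F s
        + r0 * q / (eBG * eTG) * torsion F s"
      using nz by (simp add: divide_simps) (simp add: algebra_simps)
    have "r0 * (eBF * curvature F s * x + torsion F s * y) = torsion G s * eBG"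
      using arg_cong[OF rel[OF s], of "\<lambda>v. mdot v (binormal G s)"] s
      by (simp add: mdot_simps perp x y eBG del: scaleR_add_right)
    then show "torsion G s = r0 * eBF * x / eBG * curvature F s + r0 * y / eBG * torsion F s"
      using nz by (simp add: divide_simps) (simp add: algebra_simps)
  qed
qed

text \<open>If curvature is a constant multiple of torsion for one frame, the linear relations make
  both curvature and torsion of \<open>G\<close> constant multiples of that torsion. So the torsion
  of \<open>G\<close> vanishes everywhere or nowhere, and one point with nonzero torsion decides
  which.\<close>

lemma helix_parallel_normals:
  assumes I: "is_interval I" "interior I \<noteq> {}"
    and "helix I \<alpha>" and F: "frenet_curve I \<alpha> F" and G: "frenet_curve I \<gamma> G"
    and par: "parallel_normals I F G" and tors: "\<exists>s\<in>I. torsion G s \<noteq> 0"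
  shows "helix I \<gamma>"
proof -
  obtain H k where H: "frenet_curve I \<alpha> H"
    and H0: "\<And>s. s \<in> I \<Longrightarrow> torsion H s \<noteq> 0"
    and k: "\<And>s. s \<in> I \<Longrightarrow> curvature H s / torsion H s = k"
    using \<open>helix I \<alpha>\<close> unfolding helix_def by blast
  \<comment> \<open>The frame \<open>H\<close> witnessing the helix property may differ from
    \<open>F\<close>; both frame the same curve.\<close>
  have "parallel_normals I H G"
    using parallel_normals_trans[OF parallel_normals_same_curve[OF I H F] par] .
  then obtain a b c d where
    rel: "\<And>s. s \<in> I \<Longrightarrow> curvature G s = a * curvature H s + b * torsion H s"
      "\<And>s. s \<in> I \<Longrightarrow> torsion G s = c * curvature H s + d * torsion H s"
    using parallel_normals_linear_relation[OF I H G] by blast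
  have kH: "curvature H s = k * torsion H s" if "s \<in> I" for s
    using k[OF that] H0[OF that] by (simp add: field_simps)
  have eq: "curvature G s = (a * k + b) * torsion H s" "torsion G s = (c * k + d) * torsion H s"
    if "s \<in> I" for s
    using rel[OF that] kH[OF that] by (simp_all add: algebra_simps)
  have nz: "c * k + d \<noteq> 0" using tors eq by auto
  have "curvature G s \<noteq> 0 \<and> torsion G s \<noteq> 0" if "s \<in> I" for s
    using frenet_curveD(7)[OF G that] eq(2)[OF that] nz H0[OF that] by simp
  moreover have "curvature G s / torsion G s = (a * k + b) / (c * k + d)" if "s \<in> I" for s
    using eq[OF that] H0[OF that] by simp
  ultimately show ?thesis
    unfolding helix_def using G by blast
qed

text \<open>Equal normals are given only for some pair of frames \<open>F'\<close>,
  \<open>G'\<close>. Arbitrary frames are reached through the chain \<open>F\<close>,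
  \<open>F'\<close>, \<open>G'\<close>, \<open>G\<close>.\<close>

lemma bertrand_direction_parallel_normals:
  assumes I: "is_interval I" "interior I \<noteq> {}"
    and "bertrand_direction_curve I \<beta> \<alpha>"
    and F: "frenet_curve I \<alpha> F" and G: "frenet_curve I \<beta> G"
  shows "parallel_normals I F G"
proof -
  obtain F' G' where F': "frenet_curve I \<alpha> F'" and G': "frenet_curve I \<beta> G'"
    and N: "\<And>s. s \<in> I \<Longrightarrow> normal G' s = normal F' s"
    using assms(3) unfolding bertrand_direction_curve_def direction_curve_def by blast
  have "parallel_normals I F' G'"
    unfolding parallel_normals_def using N by (auto intro!: exI[of _ 1])
  then show ?thesis
    using parallel_normals_same_curve[OF I] parallel_normals_trans F F' G G' by blast
qed

text \<open>The field is the tangent itself, the case of angle 0: coefficients 1, 0, 0, with the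
  constant causal character of the tangent as its squared length.\<close>

lemma bertrand_direction_curve_refl:
  assumes "convex I" and "I \<noteq> {}" and F: "frenet_curve I \<alpha> F"
  shows "bertrand_direction_curve I \<alpha> \<alpha>"
proof -
  note FD = frenet_curveD[OF F]
  obtain \<delta> where \<delta>: "\<And>s. s \<in> I \<Longrightarrow> mdot (tangent F s) (tangent F s) = \<delta>"
    by (rule mdot_constant[OF \<open>convex I\<close> FD(9) FD(9)])
      (use FD(4) in \<open>simp_all add: mdot_simps mdot_commute\<close>)
  obtain s0 where "s0 \<in> I" using \<open>I \<noteq> {}\<close> by blast
  then have "\<delta> \<in> {1, -1}" using FD(1)[of s0] \<delta>[of s0] by auto
  have "unit_field_along I F (tangent F)"
    unfolding unit_field_along_def
    by (rule exI[of _ "\<lambda>_. 1"], rule exI[of _ "\<lambda>_. 0"], rule exI[of _ "\<lambda>_. 0"])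
      (use \<open>\<delta> \<in> {1, -1}\<close> \<delta> in auto)
  then show ?thesis
    unfolding bertrand_direction_curve_def direction_curve_def using F by blast
qed

theorem theorem5p3:
  fixes I :: "real set" and \<alpha> \<beta> :: "real \<Rightarrow> real^3" and F G :: frenet_data
  assumes "is_interval I" and "interior I \<noteq> {}"
    and "nonlightlike_curve I \<alpha>" and "frenet_curve I \<alpha> F"
    and "nonlightlike_curve I \<beta>" and "frenet_curve I \<beta> G"
    and "bertrand_direction_curve I \<beta> \<alpha>"
    and "\<exists>s\<in>I. torsion F s \<noteq> 0"
  shows "(helix I \<alpha> \<longleftrightarrow> (\<exists>\<gamma>. helix I \<gamma> \<and> bertrand_donor_curve I \<alpha> \<gamma>)) \<and>
         (helix I \<alpha> \<longleftrightarrow> (\<exists>\<gamma>. bertrand_direction_curve I \<gamma> \<alpha> \<and> helix I \<gamma>)) \<and>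
         ((\<exists>s\<in>I. torsion G s \<noteq> 0) \<longrightarrow> (helix I \<alpha> \<longleftrightarrow> helix I \<beta>))"
proof -
  note I = assms(1,2) and F = assms(4) and G = assms(6)
  have "I \<noteq> {}" using I(2) by auto
  then have self: "bertrand_direction_curve I \<alpha> \<alpha>"
    using bertrand_direction_curve_refl[OF _ _ F] I(1) by (simp add: is_interval_convex)
  \<comment> \<open>Parallelism of normals is symmetric, so the helix property also passes back from
    a Bertrand-direction curve to \<alpha>, whose torsion is nonzero somewhere.\<close>
  have transfer: "helix I \<alpha>" if \<gamma>: "helix I \<gamma>" "bertrand_direction_curve I \<gamma> \<alpha>" for \<gamma>
  proof -
    obtain H where H: "frenet_curve I \<gamma> H"
      using \<gamma>(1) unfolding helix_def by blast
    have "parallel_normals I H F"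
      using bertrand_direction_parallel_normals[OF I \<gamma>(2) F H] by (rule parallel_normals_sym)
    then show ?thesis
      by (rule helix_parallel_normals[OF I \<gamma>(1) H F _ assms(8)])
  qed
  have "helix I \<beta>" if "helix I \<alpha>" "\<exists>s\<in>I. torsion G s \<noteq> 0"
    by (rule helix_parallel_normals[OF I that(1) F G
          bertrand_direction_parallel_normals[OF I assms(7) F G] that(2)])
  \<comment> \<open>In both existence statements, \<alpha> itself is the witness when \<alpha> is a
    helix.\<close>
  then show ?thesis
    unfolding bertrand_donor_curve_def using self transfer assms(7) by blast
qed

end
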